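(* Let $1\le m<n$ be integers such that the difference $n-m$ is even, and set $k=\frac{n-m-2}{2}$ and $l=\frac m2$. Then for all $0\le\delta<1$ $$\psi\bigg(\frac{\delta}{\sqrt{1-\delta^2}}\bigg)=\sum_{j=0}^{k}\frac{\Gamma(k+l+1)}{\Gamma(k-j+1)\,\Gamma(l+j+1)}\,(1-\delta^2)^{k-j}\,\delta^{2(l+j)},$$ and this function is a polynomial of degree $n-2$ in $\delta$.
   Context: For integers $1\le m<n$, the function $\psi$ (depending on $m$ and $n$) is defined for $\varepsilon\ge 0$ by $$\psi(\varepsilon)=\frac{2\,\Gamma(n/2)}{\Gamma(m/2)\,\Gamma((n-m)/2)}\int_0^{\varepsilon}\frac{t^{m-1}}{(1+t^2)^{n/2}}\,dt .$$ Here $\Gamma$ is the Gamma function. *)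

theory Defs
  imports "HOL-Analysis.Analysis" "HOL-Computational_Algebra.Polynomial"
begin

definition psi :: "nat \<Rightarrow> nat \<Rightarrow> real \<Rightarrow> real" where
  "psi m n \<epsilon> =
     2 * Gamma (real n / 2) / (Gamma (real m / 2) * Gamma ((real n - real m) / 2)) *
     integral {0..\<epsilon>} (\<lambda>t. t ^ (m - 1) / (1 + t\<^sup>2) powr (real n / 2))"

end

theory Submission
  imports Defs
begin

text \<open>The substitution \<open>x = t / sqrt (1 + t\<^sup>2)\<close> turns the integrand defining \<open>psi\<close> into
  \<open>x ^ (m - 1) * (1 - x\<^sup>2) ^ k\<close>, because \<open>1 - x\<^sup>2 = 1 / (1 + t\<^sup>2)\<close> and
  \<open>dx = (1 + t\<^sup>2) powr (-3/2) dt\<close>; the exponents of \<open>1 + t\<^sup>2\<close> add up correctly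
  because \<open>n = m + 2 * k + 2\<close>.
  So it suffices to find the antiderivative of this polynomial that vanishes at \<open>0\<close>.

  Repeated integration by parts, each time integrating the power of \<open>x\<close> and differentiating
  the power of \<open>1 - x\<^sup>2\<close>, yields the sum in the theorem, here called \<open>psi_poly\<close>. Read
  backwards, its derivative telescopes (\<open>pderiv_psi_poly\<close>). The same derivative settles the
  degree: a polynomial whose derivative has degree \<open>m - 1 + 2 * k\<close> and is not zero has degree
  \<open>m + 2 * k = n - 2\<close>, so no alternating sum of coefficients has to be evaluated.\<close>

definition psi_coeff :: "nat \<Rightarrow> real \<Rightarrow> nat \<Rightarrow> real" where
  "psi_coeff k l j =
     Gamma (real k + l + 1) / (Gamma (real k - real j + 1) * Gamma (l + real j + 1))"

definition psi_poly :: "nat \<Rightarrow> nat \<Rightarrow> real poly" where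
  "psi_poly m k = (\<Sum>j=0..k. smult (psi_coeff k (real m / 2) j)
     ([:1, 0, -1:] ^ (k - j) * monom 1 (m + 2 * j)))"

text \<open>This recurrence is what makes the derivative telescope. It also holds at \<open>j = k\<close>, where
  both sides vanish: the convention \<open>Gamma 0 = 0\<close> together with \<open>x / 0 = 0\<close> gives
  \<open>psi_coeff k l (k + 1)\<close> the value \<open>0\<close>, which is also that of \<open>1 / Gamma\<close> at its zero.\<close>

lemma psi_coeff_Suc:
  assumes "0 < l" "j \<le> k"
  shows "psi_coeff k l (Suc j) * (l + real (Suc j)) = psi_coeff k l j * (real k - real j)"
proof (cases "j = k")
  case True
  then show ?thesis by (simp add: psi_coeff_def)
next
  case False
  with assms have jk: "real k - real j > 0" by simp
  have G1: "Gamma (real k - real j + 1) = (real k - real j) * Gamma (real k - real j)"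
    using jk by (intro Gamma_plus1) (auto dest: nonpos_Ints_nonpos)
  have G2: "Gamma (l + real j + 1 + 1) = (l + real j + 1) * Gamma (l + real j + 1)"
    using assms by (intro Gamma_plus1) (auto dest: nonpos_Ints_nonpos)
  have args: "real k - real (Suc j) + 1 = real k - real j"
    "l + real (Suc j) + 1 = l + real j + 1 + 1" "l + real (Suc j) = l + real j + 1" by simp_all
  have cancel: "N / (g * (e * h)) * e = N / (d * g * h) * d" if "d \<noteq> 0" "e \<noteq> 0"
    for N g h d e :: real
    using that by simp
  show ?thesis
    unfolding psi_coeff_def args G1 G2 by (rule cancel) (use jk assms in auto)
qed

text \<open>The product rule splits the derivative of a summand into two terms of the same shape
  \<open>U\<close>: differentiating the power of \<open>x\<close> gives the one with index \<open>j\<close>, differentiating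
  \<open>(1 - x\<^sup>2) ^ (k - j)\<close> gives the one with index \<open>j + 1\<close>, by the coefficient recurrence.\<close>

lemma pderiv_psi_poly_term:
  assumes "1 \<le> m" "j \<le> k"
  defines "l \<equiv> real m / 2"
  defines "U \<equiv> \<lambda>j. smult (2 * psi_coeff k l j * (l + real j))
             ([:1, 0, -1:] ^ (k - j) * monom 1 (m + 2 * j - 1))"
  shows "pderiv (smult (psi_coeff k l j) ([:1, 0, -1:] ^ (k - j) * monom 1 (m + 2 * j)))
         = U j - U (Suc j)"
proof -
  let ?q = "[:1, 0, -1:] :: real poly"
  have l: "l > 0" using assms by simp
  have U': "U (Suc j) = smult (2 * psi_coeff k l j * (real k - real j))
             (?q ^ (k - Suc j) * monom 1 (m + 2 * j + 1))"
    using psi_coeff_Suc[OF l assms(2)] by (simp add: U_def mult.assoc)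
  have "pderiv ?q = monom (- 2) 1"
    by (simp add: pderiv_pCons monom_Suc monom_0)
  then have dq: "pderiv (?q ^ (k - j)) =
      smult (real (k - j)) (?q ^ (k - Suc j) * monom (- 2) 1)"
    by (simp add: pderiv_power)
  have mon: "monom (- 2) 1 * monom 1 (m + 2 * j) = smult (- 2) (monom (1::real) (m + 2 * j + 1))"
    by (simp add: mult_monom smult_monom)
  have dm: "pderiv (monom 1 (m + 2 * j)) =
      smult (2 * (l + real j)) (monom 1 (m + 2 * j - 1))"
    by (simp add: pderiv_monom smult_monom l_def)
  have rkj: "real (k - j) = real k - real j" using assms by simp
  have "monom 1 (m + 2 * j) * pderiv (?q ^ (k - j)) =
      smult (real k - real j) (?q ^ (k - Suc j) * (monom (- 2) 1 * monom 1 (m + 2 * j)))"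
    unfolding dq rkj by (simp only: mult_smult_right mult_smult_left mult.assoc
        mult.commute[of "monom 1 (m + 2 * j)"])
  also have "\<dots> = - smult (2 * (real k - real j)) (?q ^ (k - Suc j) * monom 1 (m + 2 * j + 1))"
    unfolding mon mult_smult_right smult_smult
    by (simp only: smult_minus_left[symmetric]) (simp add: mult.commute)
  finally have "pderiv (?q ^ (k - j) * monom 1 (m + 2 * j)) =
      smult (2 * (l + real j)) (?q ^ (k - j) * monom 1 (m + 2 * j - 1))
      - smult (2 * (real k - real j)) (?q ^ (k - Suc j) * monom 1 (m + 2 * j + 1))"
    unfolding pderiv_mult dm mult_smult_right by simp
  then show ?thesis
    unfolding U' unfolding U_def pderiv_smult by (simp only: smult_diff_right smult_smult ac_simps)
qed

text \<open>Of the telescoping sum only \<open>U 0\<close> survives, since \<open>U (k + 1)\<close> has coefficient \<open>0\<close>. The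
  factor on the right is exactly the normalising constant of \<open>psi\<close> for \<open>n = m + 2 * k + 2\<close>.\<close>

lemma pderiv_psi_poly:
  assumes "1 \<le> m"
  shows "pderiv (psi_poly m k) =
     smult (2 * Gamma (real k + real m / 2 + 1) / (Gamma (real m / 2) * Gamma (real k + 1)))
       ([:1, 0, -1:] ^ k * monom 1 (m - 1))"
proof -
  define l where "l = real m / 2"
  define U where "U = (\<lambda>j. smult (2 * psi_coeff k l j * (l + real j))
             ([:1, 0, -1:] ^ (k - j) * monom 1 (m + 2 * j - 1)))"
  have l: "l > 0" using assms by (simp add: l_def)
  have "pderiv (psi_poly m k) = (\<Sum>j=0..k. U j - U (Suc j))"
    unfolding psi_poly_def U_def l_def higher_pderiv_sum[of 1, simplified]
    by (intro sum.cong refl pderiv_psi_poly_term) (use assms in auto)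
  also have "\<dots> = U 0 - U (Suc k)"
    using sum_telescope[of U k] by (simp add: atLeast0AtMost)
  also have "U (Suc k) = 0"
    by (simp add: U_def psi_coeff_def)
  also have "2 * psi_coeff k l 0 * l = 2 * Gamma (real k + l + 1) / (Gamma l * Gamma (real k + 1))"
  proof -
    have "Gamma (l + 1) = l * Gamma l"
      using l by (intro Gamma_plus1) (auto dest: nonpos_Ints_nonpos)
    then show ?thesis using l by (simp add: psi_coeff_def)
  qed
  then have "U 0 - 0 = smult (2 * Gamma (real k + l + 1) / (Gamma l * Gamma (real k + 1)))
       ([:1, 0, -1:] ^ k * monom 1 (m - 1))"
    by (simp add: U_def)
  finally show ?thesis by (simp add: l_def)
qed

lemma degree_psi_poly:
  assumes "1 \<le> m"
  shows "degree (psi_poly m k) = m + 2 * k"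
proof -
  let ?q = "[:1, 0, -1:] :: real poly"
  have c: "2 * Gamma (real k + real m / 2 + 1) / (Gamma (real m / 2) * Gamma (real k + 1)) \<noteq> 0"
    using assms by (auto simp: Gamma_eq_zero_iff dest!: nonpos_Ints_nonpos)
  have q: "?q ^ k \<noteq> 0" "monom (1::real) (m - 1) \<noteq> 0" by (simp_all add: monom_eq_0_iff)
  have "degree (pderiv (psi_poly m k)) = 2 * k + (m - 1)"
    unfolding pderiv_psi_poly[OF assms] degree_smult_eq
    using c q by (simp add: degree_mult_eq degree_power_eq degree_monom_eq)
  then have "degree (psi_poly m k) - 1 = 2 * k + (m - 1)"
    by (simp add: degree_pderiv)
  \<comment> \<open>For \<open>m = 1\<close> and \<open>k = 0\<close> the truncated subtraction leaves degree \<open>0\<close> to be excluded.\<close>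
  moreover have "degree (psi_poly m k) \<noteq> 0"
  proof -
    have "pderiv (psi_poly m k) \<noteq> 0"
      unfolding pderiv_psi_poly[OF assms] using c q by simp
    then show ?thesis by (simp add: pderiv_eq_0_iff)
  qed
  ultimately show ?thesis using assms by linarith
qed

lemma has_derivative_over_sqrt_one_plus_square:
  "((\<lambda>t. t / sqrt (1 + t\<^sup>2)) has_real_derivative 1 / sqrt (1 + t\<^sup>2) ^ 3) (at t within S)"
proof -
  have pos: "1 + t\<^sup>2 > 0" by (simp add: add_pos_nonneg)
  have sq: "sqrt (1 + t\<^sup>2) ^ 2 = 1 + t\<^sup>2" using pos by simp
  define w where "w = sqrt (1 + t\<^sup>2)"
  have w: "w > 0" "t * t = w * w - 1" using pos sq by (auto simp: w_def power2_eq_square)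
  have "((\<lambda>t. t / sqrt (1 + t\<^sup>2)) has_real_derivative
      (w - t * (t / w)) / (w * w)) (at t within S)"
    unfolding w_def using pos
    by (auto intro!: derivative_eq_intros simp: divide_simps)
  moreover have "(w - t * (t / w)) / (w * w) = 1 / w ^ 3"
    using w by (simp add: field_simps power3_eq_cube)
  ultimately show ?thesis by (simp add: w_def)
qed

text \<open>The change of variables is carried out by differentiating the composition of \<open>psi_poly\<close>
  with the substitution and applying the fundamental theorem of calculus; the lower limit
  contributes nothing because every summand of \<open>psi_poly\<close> is divisible by \<open>x ^ m\<close>.\<close>

lemma psi_eq_poly:
  assumes "1 \<le> m" "0 \<le> \<epsilon>"
  shows "psi m (m + 2 * k + 2) \<epsilon> = poly (psi_poly m k) (\<epsilon> / sqrt (1 + \<epsilon>\<^sup>2))"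
proof -
  define n where "n = m + 2 * k + 2"
  define C where "C = 2 * Gamma (real k + real m / 2 + 1) / (Gamma (real m / 2) * Gamma (real k + 1))"
  define f where "f = (\<lambda>t::real. t ^ (m - 1) / (1 + t\<^sup>2) powr (real n / 2))"
  define G where "G = (\<lambda>t. poly (psi_poly m k) (t / sqrt (1 + t\<^sup>2)))"
  have deriv: "(G has_real_derivative C * f t) (at t within S)" for t :: real and S
  proof -
    define w where "w = sqrt (1 + t\<^sup>2)"
    have pos: "1 + t\<^sup>2 > 0" by (simp add: add_pos_nonneg)
    have w: "w > 0" "1 + t\<^sup>2 = w\<^sup>2" using pos by (auto simp: w_def)
    have "(1 + t\<^sup>2) powr (real n / 2) = w powr real n"
      unfolding w_def by (simp add: powr_half_sqrt[symmetric] powr_powr)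
    also have "\<dots> = w ^ n" using w by (simp add: powr_realpow)
    finally have f: "f t = t ^ (m - 1) / w ^ n" by (simp add: f_def)
    have one: "1 - (t / w)\<^sup>2 = 1 / w\<^sup>2"
      using w by (simp add: field_simps)
    have "poly (pderiv (psi_poly m k)) (t / w) = C * (1 - (t / w)\<^sup>2) ^ k * (t / w) ^ (m - 1)"
      unfolding pderiv_psi_poly[OF assms(1)] C_def
      by (simp add: poly_monom power2_eq_square)
    also have "\<dots> = C * (t ^ (m - 1) / w ^ (m - 1 + 2 * k))"
      unfolding one by (simp add: power_divide power_mult power_add)
    finally have "poly (pderiv (psi_poly m k)) (t / w) * (1 / w ^ 3)
        = C * (t ^ (m - 1) / (w ^ (m - 1 + 2 * k) * w ^ 3))" by simp
    also have "w ^ (m - 1 + 2 * k) * w ^ 3 = w ^ n"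
      unfolding power_add[symmetric] using assms(1) by (simp add: n_def)
    finally have eq: "poly (pderiv (psi_poly m k)) (t / w) * (1 / w ^ 3) = C * f t"
      by (simp add: f)
    have "(G has_real_derivative poly (pderiv (psi_poly m k)) (t / w) * (1 / w ^ 3))
        (at t within S)"
      unfolding G_def w_def
      by (rule DERIV_chain2[OF poly_DERIV has_derivative_over_sqrt_one_plus_square])
    then show ?thesis by (simp only: eq)
  qed
  have "((\<lambda>t. C * f t) has_integral (G \<epsilon> - G 0)) {0..\<epsilon>}"
    using assms(2) deriv
    by (intro fundamental_theorem_of_calculus)
       (auto simp flip: has_real_derivative_iff_has_vector_derivative)
  moreover have "G 0 = 0"
    using assms(1) by (simp add: G_def psi_poly_def poly_sum poly_monom zero_power)
  ultimately have "integral {0..\<epsilon>} (\<lambda>t. C * f t) = G \<epsilon>"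
    by (metis integral_unique diff_zero)
  moreover have "psi m n \<epsilon> = C * integral {0..\<epsilon>} f"
    unfolding psi_def C_def f_def n_def by (simp add: add_divide_distrib ac_simps)
  ultimately show ?thesis by (simp add: G_def n_def)
qed

theorem theorem3p2:
  fixes m n k :: nat and l :: real
  assumes "1 \<le> m" and "m < n" and "even (n - m)"
    and "real k = (real n - real m - 2) / 2" and "l = real m / 2"
  shows "(\<forall>\<delta>::real. 0 \<le> \<delta> \<and> \<delta> < 1 \<longrightarrow>
            psi m n (\<delta> / sqrt (1 - \<delta>\<^sup>2)) =
            (\<Sum>j = 0..k. Gamma (real k + l + 1) / (Gamma (real k - real j + 1) * Gamma (l + real j + 1)) *
                (1 - \<delta>\<^sup>2) ^ (k - j) * \<delta> powr (2 * (l + real j)))) \<and>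
         (\<exists>p :: real poly. degree p = n - 2 \<and>
            (\<forall>\<delta>::real. 0 \<le> \<delta> \<and> \<delta> < 1 \<longrightarrow>
               psi m n (\<delta> / sqrt (1 - \<delta>\<^sup>2)) = poly p \<delta>))"
proof -
  have "real n = real (m + 2 * k + 2)" using assms(4) by simp
  then have n: "n = m + 2 * k + 2" by linarith
  have psi: "psi m n (\<delta> / sqrt (1 - \<delta>\<^sup>2)) = poly (psi_poly m k) \<delta>"
    if "0 \<le> \<delta>" "\<delta> < 1" for \<delta> :: real
  proof -
    have pos: "1 - \<delta>\<^sup>2 > 0" using that by (simp add: abs_square_less_1)
    have "1 + (\<delta> / sqrt (1 - \<delta>\<^sup>2))\<^sup>2 = 1 / (1 - \<delta>\<^sup>2)"
      using pos by (simp add: power_divide field_simps)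
    then have "\<delta> / sqrt (1 - \<delta>\<^sup>2) / sqrt (1 + (\<delta> / sqrt (1 - \<delta>\<^sup>2))\<^sup>2) = \<delta>"
      using pos by (simp add: real_sqrt_divide)
    then show ?thesis
      using psi_eq_poly[OF assms(1), of "\<delta> / sqrt (1 - \<delta>\<^sup>2)" k] that pos by (simp add: n)
  qed
  have expand: "poly (psi_poly m k) \<delta> =
      (\<Sum>j = 0..k. Gamma (real k + l + 1) / (Gamma (real k - real j + 1) * Gamma (l + real j + 1)) *
                (1 - \<delta>\<^sup>2) ^ (k - j) * \<delta> powr (2 * (l + real j)))"
    if "0 \<le> \<delta>" for \<delta> :: real
  proof -
    have "\<delta> powr (2 * (l + real j)) = \<delta> ^ (m + 2 * j)" for j
    proof -
      have "2 * (l + real j) = real (m + 2 * j)" using assms(5) by simp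
      then show ?thesis
        using that assms(1) by (simp only: powr_realpow')
    qed
    then show ?thesis
      unfolding psi_poly_def
      by (simp add: poly_sum poly_monom psi_coeff_def assms(5) power2_eq_square mult.assoc)
  qed
  have "degree (psi_poly m k) = n - 2"
    using degree_psi_poly[OF assms(1)] n by simp
  with psi expand show ?thesis by auto
qed

end
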